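(* For every integer $r\geq 3$, the number of $4\times 4$ Hadamard matrices $\mathrm{Hada}(a,b,c,d)$ over the finite field $\mathbb{F}_{2^r}$ that are MDS matrices is exactly $$(2^r-1)(2^r-2)(2^r-4)(2^r-7).$$
   Context: For $a,b,c,d\in\mathbb{F}_{2^r}$, $\mathrm{Hada}(a,b,c,d)$ denotes the (finite field) Hadamard matrix $$\begin{bmatrix} a&b&c&d\\ b&a&d&c\\ c&d&a&b\\ d&c&b&a\end{bmatrix}.$$ A square matrix $M$ over a field is an MDS matrix if every square submatrix of $M$ (formed by any $i$ rows and any $i$ columns, $i\ge 1$, including $M$ itself) is nonsingular; in particular all entries are nonzero. *)

theory Defs
  imports
    "Jordan_Normal_Form.Determinant"
    "Jordan_Normal_Form.DL_Submatrix"
begin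

definition Hada :: "'a \<Rightarrow> 'a \<Rightarrow> 'a \<Rightarrow> 'a \<Rightarrow> 'a mat" where
  "Hada a b c d = mat_of_rows_list 4
     [[a, b, c, d],
      [b, a, d, c],
      [c, d, a, b],
      [d, c, b, a]]"

(* submatrix A I J keeps the rows with index in I and the columns with index in J,
   in increasing order; indices start at 0. *)
definition mds_mat :: "'a :: field mat \<Rightarrow> bool" where
  "mds_mat A \<longleftrightarrow> square_mat A \<and>
     (\<forall>I J. I \<subseteq> {..<dim_row A} \<longrightarrow> J \<subseteq> {..<dim_col A} \<longrightarrow> card I = card J \<longrightarrow> card I \<ge> 1 \<longrightarrow>
        det (submatrix A I J) \<noteq> 0)"

end

(* Over a field of characteristic 2 with s = a + b + c + d, the matrix H = Hada a b c d satisfies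
   H * H = s^2 * 1. Hence det H is nonzero iff s is, and every 3 x 3 minor is s^2 times an entry.
   The 2 x 2 minors are squares of sums of two entries or expressions such as a * b + c * d, so
   being MDS means: nonzero distinct entries, s nonzero and the products of complementary pairs
   distinct. After scaling to a = 1, for given b and c the entry d avoids eight expressions, among
   which coincide exactly as many pairs as hold among the equations c = 1 + b, b c = 1, b = c^2,
   c = b^2. Each equation has q - 2 solutions, so the number of triples (b, c, d) is
   (q - 2) (q - 3) (q - 8) + 4 (q - 2) = (q - 2) (q - 4) (q - 7). *)
theory Submission
  imports Defs "HOL-Number_Theory.Residues"
begin

section \<open>Submatrices given by index lists, and small determinants\<close>

text \<open>Exactly \<open>i\<close> members of the set lie below \<open>xs ! i\<close>, and
  \<open>pick\<close> recovers a member from the number of smaller ones.\<close>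

lemma nth_eq_pick_set:
  assumes "sorted_wrt (<) xs" and "i < length xs"
  shows "pick (set xs) i = xs ! i"
proof -
  have "{a \<in> set xs. a < xs ! i} = (!) xs ` {..<i}"
    using assms
    by (auto simp: in_set_conv_nth sorted_wrt_iff_nth_less image_iff Bex_def)
      (metis linorder_neqE_nat not_less_iff_gr_or_eq, metis order_less_trans)
  moreover have "inj_on ((!) xs) {..<i}"
    using assms by (auto intro!: inj_on_nth simp: strict_sorted_iff)
  ultimately have "card {a \<in> set xs. a < xs ! i} = i"
    by (simp add: card_image)
  then show ?thesis
    using pick_card_in_set[of "xs ! i" "set xs"] assms(2) by simp
qed

lemma submatrix_set:
  assumes xs: "sorted_wrt (<) xs" "set xs \<subseteq> {..<dim_row A}"
    and ys: "sorted_wrt (<) ys" "set ys \<subseteq> {..<dim_col A}"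
  shows "submatrix A (set xs) (set ys) = mat (length xs) (length ys) (\<lambda>(i, j). A $$ (xs ! i, ys ! j))"
proof -
  have "card {i. i < n \<and> i \<in> set zs} = length zs"
    if "sorted_wrt (<) zs" "set zs \<subseteq> {..<n}" for zs and n :: nat
  proof -
    have "{i. i < n \<and> i \<in> set zs} = set zs" using that(2) by blast
    then show ?thesis using that(1) by (simp add: strict_sorted_iff distinct_card)
  qed
  then have "submatrix A (set xs) (set ys) =
      mat (length xs) (length ys) (\<lambda>(i, j). A $$ (pick (set xs) i, pick (set ys) j))"
    unfolding submatrix_def using assms by presburger
  also have "\<dots> = mat (length xs) (length ys) (\<lambda>(i, j). A $$ (xs ! i, ys ! j))"
    by (rule cong_mat) (simp_all only: nth_eq_pick_set xs ys split)
  finally show ?thesis .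
qed

text \<open>Laplace expansion along row 0: deleting column \<open>j\<close> shifts every column
  index from \<open>j\<close> on by one.\<close>

lemma det_mat_Suc:
  fixes f :: "nat \<times> nat \<Rightarrow> 'a :: comm_ring_1"
  shows "det (mat (Suc n) (Suc n) f) =
    (\<Sum>j<Suc n. f (0, j) * ((-1) ^ j *
      det (mat n n (\<lambda>(i, k). f (Suc i, if k < j then k else Suc k)))))"
proof -
  have "mat_delete (mat (Suc n) (Suc n) f) 0 j =
      mat n n (\<lambda>(i, k). f (Suc i, if k < j then k else Suc k))" if "j < Suc n" for j
    using that by (auto simp: mat_delete_def)
  then show ?thesis
    by (subst laplace_expansion_row[of _ "Suc n" 0]) (auto simp: cofactor_def intro!: sum.cong)
qed

lemma det_mat_1: "det (mat (Suc 0) (Suc 0) f) = f (0, 0)"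
  by (simp add: det_mat_Suc)

lemma det_mat_2: "det (mat 2 2 f) = f (0, 0) * f (1, 1) - f (0, 1) * f (1, 0)"
  by (simp add: numeral_2_eq_2 det_mat_Suc)

lemma det_mat_3: "det (mat 3 3 f) =
    f (0, 0) * (f (1, 1) * f (2, 2) - f (1, 2) * f (2, 1))
  - f (0, 1) * (f (1, 0) * f (2, 2) - f (1, 2) * f (2, 0))
  + f (0, 2) * (f (1, 0) * f (2, 1) - f (1, 1) * f (2, 0))"
  by (simp add: numeral_2_eq_2 numeral_3_eq_3 det_mat_Suc algebra_simps)

text \<open>Finite sets of naturals correspond to strictly increasing lists via \<open>set\<close>
  and \<open>sorted_list_of_set\<close>. With lists, each minor becomes an explicit polynomial in
  the entries.\<close>

lemma mds_mat_iff:
  assumes "A \<in> carrier_mat n n"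
  shows "mds_mat A \<longleftrightarrow>
    (\<forall>xs ys. sorted_wrt (<) xs \<longrightarrow> sorted_wrt (<) ys \<longrightarrow> set xs \<subseteq> {..<n} \<longrightarrow> set ys \<subseteq> {..<n} \<longrightarrow>
      length xs = length ys \<longrightarrow> xs \<noteq> [] \<longrightarrow>
      det (mat (length xs) (length ys) (\<lambda>(i, j). A $$ (xs ! i, ys ! j))) \<noteq> 0)"
    (is "_ \<longleftrightarrow> ?R")
proof
  assume A: "mds_mat A"
  show ?R
  proof (intro allI impI)
    fix xs ys :: "nat list"
    assume xs: "sorted_wrt (<) xs" "set xs \<subseteq> {..<n}" and ys: "sorted_wrt (<) ys" "set ys \<subseteq> {..<n}"
      and len: "length xs = length ys" "xs \<noteq> []"
    have "card (set xs) = length xs" "card (set ys) = length ys"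
      using xs ys by (simp_all add: strict_sorted_iff distinct_card)
    moreover have "length ys \<ge> 1"
      using len by (cases ys) auto
    ultimately have "det (submatrix A (set xs) (set ys)) \<noteq> 0"
      using A assms xs ys len by (simp add: mds_mat_def)
    then show "det (mat (length xs) (length ys) (\<lambda>(i, j). A $$ (xs ! i, ys ! j))) \<noteq> 0"
      using submatrix_set[of xs A ys] assms xs ys by simp
  qed
next
  assume R: ?R
  have "det (submatrix A I J) \<noteq> 0"
    if "I \<subseteq> {..<n}" "J \<subseteq> {..<n}" "card I = card J" "card I \<ge> 1" for I J
  proof -
    have "finite I" "finite J"
      using that finite_subset by blast+
    moreover from this have "sorted_list_of_set I \<noteq> []"
      using that(4) by auto
    ultimately show ?thesis
      using R[rule_format, of "sorted_list_of_set I" "sorted_list_of_set J"]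
        submatrix_set[of "sorted_list_of_set I" A "sorted_list_of_set J"] that assms
      by simp
  qed
  then show "mds_mat A"
    using assms unfolding mds_mat_def by auto
qed

section \<open>Parameter conditions and entries of Hadamard matrices\<close>

definition mds_params :: "'a :: field \<Rightarrow> 'a \<Rightarrow> 'a \<Rightarrow> 'a \<Rightarrow> bool" where
  "mds_params a b c d \<longleftrightarrow>
     0 \<notin> {a, b, c, d} \<and> distinct [a, b, c, d] \<and> a * b \<noteq> c * d \<and> a * c \<noteq> b * d \<and> a * d \<noteq> b * c \<and>
     a + b + c + d \<noteq> 0"

text \<open>All the conditions are homogeneous, of degree 1 or 2. This permits normalising the first
  entry to 1.\<close>

lemma mds_params_scale:
  fixes a b c d e :: "'a :: field"
  assumes "e \<noteq> 0"
  shows "mds_params (e * a) (e * b) (e * c) (e * d) \<longleftrightarrow> mds_params a b c d"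
proof -
  have "e * x * (e * y) = e * z * (e * w) \<longleftrightarrow> x * y = z * w" for x y z w
  proof -
    have "e * x * (e * y) = e * e * (x * y)" "e * z * (e * w) = e * e * (z * w)"
      by (simp_all only: ac_simps)
    then show ?thesis using assms by simp
  qed
  moreover have "e * a + e * b + e * c + e * d = e * (a + b + c + d)"
    by (simp only: distrib_left)
  ultimately show ?thesis
    using assms by (simp add: mds_params_def)
qed

text \<open>The values excluded for \<open>d\<close> when \<open>a = 1\<close> in characteristic 2:
  the first comes from the sum, the next three from the product conditions, the last four from
  nonzero distinct entries.\<close>

definition forbidden :: "'a :: field \<Rightarrow> 'a \<Rightarrow> 'a set" where
  "forbidden b c = {1 + b + c, b * c, b / c, c / b, 0, 1, b, c}"

lemma Hada_carrier [simp]: "Hada a b c d \<in> carrier_mat 4 4"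
  by (rule carrier_matI) (simp_all add: Hada_def mat_of_rows_list_def)

lemma dim_Hada [simp]: "dim_row (Hada a b c d) = 4" "dim_col (Hada a b c d) = 4"
  by (simp_all add: Hada_def mat_of_rows_list_def)

lemma Hada_index:
  assumes "i < 4" "j < 4"
  shows "Hada a b c d $$ (i, j) = [[a, b, c, d], [b, a, d, c], [c, d, a, b], [d, c, b, a]] ! i ! j"
  using assms by (simp add: Hada_def mat_of_rows_list_def)

lemma Hada_inject: "Hada a b c d = Hada a' b' c' d' \<longleftrightarrow> a = a' \<and> b = b' \<and> c = c' \<and> d = d'"
proof
  assume "Hada a b c d = Hada a' b' c' d'"
  then have "Hada a b c d $$ (0, j) = Hada a' b' c' d' $$ (0, j)" for j
    by simp
  from this[of 0] this[of 1] this[of 2] this[of 3]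
  show "a = a' \<and> b = b' \<and> c = c' \<and> d = d'"
    by (simp add: Hada_index)
qed simp

lemma less_4_cases: "i < (4::nat) \<longleftrightarrow> i = 0 \<or> i = 1 \<or> i = 2 \<or> i = 3"
  by auto

section \<open>Characteristic 2: minors of Hadamard matrices\<close>

context
  assumes two: "(2 :: 'a :: field) = 0"
begin

text \<open>The second equation cancels equal neighbours inside the right-nested sums that
  \<open>algebra_simps\<close> produces.\<close>

lemma char2_add_self: "x + x = (0 :: 'a)" "x + (x + y) = (y :: 'a)"
proof -
  have "x + x = 2 * x" for x :: 'a by simp
  then show *: "x + x = (0 :: 'a)" for x using two by simp
  show "x + (x + y) = y" using *[of x] by (simp flip: add.assoc)
qed

lemma char2_minus: "- x = (x :: 'a)" "x - y = (x + y :: 'a)"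
  using char2_add_self(1) by (simp_all add: neg_eq_iff_add_eq_0 diff_conv_add_uminus del: add_uminus_conv_diff)

lemma char2_add_eq_0_iff: "x + y = 0 \<longleftrightarrow> x = (y :: 'a)"
  using char2_minus by (metis add_eq_0_iff)

text \<open>Equal squares give \<open>x = y\<close> or \<open>x = - y\<close>, and these
  coincide.\<close>

lemma char2_square_eq_iff: "x * x = y * y \<longleftrightarrow> x = (y :: 'a)"
  using square_eq_iff[of x y] char2_minus by simp

text \<open>Off the diagonal every product occurs twice and cancels; on it stands the sum of the
  squares, which is the square of the sum.\<close>

lemma Hada_square: "Hada a b c d * Hada a b c d = (a + b + c + d)\<^sup>2 \<cdot>\<^sub>m (1\<^sub>m 4 :: 'a mat)"
proof (rule eq_matI)
  fix i j
  assume "i < dim_row ((a + b + c + d)\<^sup>2 \<cdot>\<^sub>m (1\<^sub>m 4 :: 'a mat))"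
    "j < dim_col ((a + b + c + d)\<^sup>2 \<cdot>\<^sub>m (1\<^sub>m 4 :: 'a mat))"
  then have ij: "i < 4" "j < 4" by auto
  have "(Hada a b c d * Hada a b c d) $$ (i, j) =
      (\<Sum>k\<in>{0,1,2,3}. Hada a b c d $$ (i, k) * Hada a b c d $$ (k, j))"
    using ij by (simp add: scalar_prod_def numeral_eq_Suc atLeast0_lessThan_Suc)
  then show "(Hada a b c d * Hada a b c d) $$ (i, j) = ((a + b + c + d)\<^sup>2 \<cdot>\<^sub>m 1\<^sub>m 4) $$ (i, j)"
    using ij unfolding less_4_cases
    by (elim disjE) (simp_all add: Hada_index power2_eq_square algebra_simps char2_add_self)
qed auto

lemma det_Hada_eq_0_iff: "det (Hada a b c d) = 0 \<longleftrightarrow> a + b + c + d = (0 :: 'a)"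
proof -
  have "det (Hada a b c d) * det (Hada a b c d) = ((a + b + c + d)\<^sup>2) ^ 4"
    using det_mult[OF Hada_carrier Hada_carrier, of a b c d a b c d] by (simp add: Hada_square)
  then show ?thesis
    by (metis mult_eq_0_iff power_eq_0_iff zero_neq_numeral zero_less_numeral)
qed

lemma mds_mat_Hada_iff: "mds_mat (Hada a b c d) \<longleftrightarrow> mds_params a b c (d :: 'a)"
proof
  define h where "h i j = Hada a b c d $$ (i, j)" for i j
  define M where "M xs ys = mat (length xs) (length ys) (\<lambda>(i, j). h (xs ! i) (ys ! j))" for xs ys
  note h = Hada_index[of _ _ a b c d, folded h_def]
  note mds = mds_mat_iff[OF Hada_carrier, of a b c d, folded h_def, folded M_def]
  have det_M1: "det (M [i] [j]) = h i j" for i j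
    by (simp add: M_def det_mat_1)
  have det_M2: "det (M [i, i'] [j, j']) = h i j * h i' j' - h i j' * h i' j" for i i' j j'
    by (simp add: M_def det_mat_2[unfolded numeral_2_eq_2])
  have det_M3: "det (M [i, i', i''] [j, j', j'']) =
      h i j * (h i' j' * h i'' j'' - h i' j'' * h i'' j')
    - h i j' * (h i' j * h i'' j'' - h i' j'' * h i'' j)
    + h i j'' * (h i' j * h i'' j' - h i' j' * h i'' j)" for i i' i'' j j' j''
    by (simp add: M_def det_mat_3[unfolded numeral_3_eq_3 numeral_2_eq_2])
  have M4: "M [0, 1, 2, 3] [0, 1, 2, 3] = Hada a b c d"
    by (rule eq_matI) (auto simp: M_def h_def less_4_cases)
  {
    assume "mds_mat (Hada a b c d)"
    note m = this[unfolded mds, rule_format]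
    have 1: "a \<noteq> 0" "b \<noteq> 0" "c \<noteq> 0" "d \<noteq> 0"
      using m[of "[0]" "[0]"] m[of "[0]" "[1]"] m[of "[0]" "[2]"] m[of "[0]" "[3]"]
      by (simp_all add: det_M1 h)
    \<comment> \<open>The chosen minors are, in order, the differences of the two products.\<close>
    have 2: "a * b \<noteq> c * d" "a * c \<noteq> b * d" "a * d \<noteq> b * c"
      using m[of "[0,2]" "[0,3]"] m[of "[0,1]" "[0,3]"] m[of "[0,1]" "[0,2]"]
      by (auto simp: det_M2 h mult.commute)
    \<comment> \<open>Each chosen minor is \<open>x * x - y * y\<close> for the corresponding pair
      of entries.\<close>
    have 3: "a \<noteq> b" "a \<noteq> c" "a \<noteq> d" "b \<noteq> c" "b \<noteq> d" "c \<noteq> d"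
      using m[of "[0,1]" "[0,1]"] m[of "[0,2]" "[0,2]"] m[of "[0,3]" "[0,3]"]
        m[of "[0,3]" "[1,2]"] m[of "[0,2]" "[1,3]"] m[of "[0,1]" "[2,3]"]
      by (auto simp: det_M2 h)
    have 4: "a + b + c + d \<noteq> 0"
      using m[of "[0,1,2,3]" "[0,1,2,3]"] by (simp add: M4[simplified] det_Hada_eq_0_iff)
    show "mds_params a b c d"
      using 1 2 3 4 by (simp add: mds_params_def)
  }
  assume p: "mds_params a b c d"
  have minor1: "h i j \<noteq> 0" if "i < 4" "j < 4" for i j
    using that p unfolding less_4_cases by (elim disjE) (simp_all add: h mds_params_def)
  have minor2: "h i j * h i' j' - h i j' * h i' j \<noteq> 0"
    if "i < i'" "i' < 4" "j < j'" "j' < 4" for i i' j j'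
  proof -
    have ii: "(i, i') \<in> {(0,1), (0,2), (0,3), (1,2), (1,3), (2,3)}"
      if "i < i'" "i' < 4" for i i' :: nat
      using that by auto
    \<comment> \<open>A minor may show the two products in either order, so both orientations are
      supplied.\<close>
    have "a * b \<noteq> c * d" "a * c \<noteq> b * d" "a * d \<noteq> b * c"
      using p by (auto simp: mds_params_def)
    note this this[THEN not_sym]
    with p show ?thesis
      using ii[OF that(1,2)] ii[OF that(3,4)]
      unfolding insert_iff empty_iff prod.inject
      by (elim disjE conjE) (simp_all add: h mds_params_def char2_square_eq_iff mult.commute)
  qed
  \<comment> \<open>Source of the identity below: for nonzero \<open>s = a + b + c + d\<close> the
    inverse of the matrix is the matrix divided by \<open>s^2\<close>, and its determinant is
    \<open>s^4\<close>. So the adjugate is \<open>s^2\<close> times the symmetric matrix itself, and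
    cofactor signs vanish in characteristic 2.\<close>
  have minor3: "det (M [i, i', i''] [j, j', j'']) \<noteq> 0"
    if "i < i'" "i' < i''" "i'' < 4" "j < j'" "j' < j''" "j'' < 4" for i i' i'' j j' j''
  proof -
    have ii: "(i, i', i'') \<in> {(0,1,2), (0,1,3), (0,2,3), (1,2,3)}"
      if "i < i'" "i' < i''" "i'' < 4" for i i' i'' :: nat
      using that by auto
    (* 6 - (i + i' + i'') is the element of {0, 1, 2, 3} missing from i, i', i''. *)
    have "det (M [i, i', i''] [j, j', j'']) =
        (a + b + c + d)\<^sup>2 * h (6 - (i + i' + i'')) (6 - (j + j' + j''))"
      using ii[OF that(1-3)] ii[OF that(4-6)]
      unfolding insert_iff empty_iff prod.inject det_M3
      by (elim disjE conjE)
        (simp_all add: h power2_eq_square algebra_simps char2_minus char2_add_self)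
    then show ?thesis
      using p that by (simp add: minor1 mds_params_def)
  qed
  have minor4: "det (Hada a b c d) \<noteq> 0"
    using p by (simp add: mds_params_def det_Hada_eq_0_iff)
  show "mds_mat (Hada a b c d)"
    unfolding mds
  proof (intro allI impI)
    fix xs ys :: "nat list"
    assume xs: "sorted_wrt (<) xs" "set xs \<subseteq> {..<4}" and ys: "sorted_wrt (<) ys" "set ys \<subseteq> {..<4}"
      and len: "length xs = length ys" "xs \<noteq> []"
    have full: "zs = [0, 1, 2, 3]" if "sorted_wrt (<) zs" "set zs \<subseteq> {..<4}" "length zs = 4"
      for zs :: "nat list"
      using that by (auto simp: numeral_eq_Suc length_Suc_conv)
    have "length xs \<le> 4"
      using xs card_mono[of "{..<4}" "set xs"] by (simp add: strict_sorted_iff distinct_card)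
    moreover have "length xs \<noteq> 0"
      using len(2) by simp
    ultimately have "length xs = 1 \<or> length xs = 2 \<or> length xs = 3 \<or> length xs = 4"
      by linarith
    then consider "length xs = 1" | "length xs = 2" | "length xs = 3" | "length xs = 4"
      by blast
    then show "det (M xs ys) \<noteq> 0"
    proof cases
      case 1
      then obtain i j where "xs = [i]" "ys = [j]"
        using len by (auto simp: length_Suc_conv)
      then show ?thesis using xs ys minor1 by (simp add: det_M1)
    next
      case 2
      with len have "length xs = Suc (Suc 0)" "length ys = Suc (Suc 0)"
        by simp_all
      then obtain i i' j j' where "xs = [i, i']" "ys = [j, j']"
        by (auto simp: length_Suc_conv)
      then show ?thesis using xs ys minor2 by (simp add: det_M2)
    next
      case 3
      with len have "length xs = Suc (Suc (Suc 0))" "length ys = Suc (Suc (Suc 0))"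
        by simp_all
      then obtain i i' i'' j j' j'' where "xs = [i, i', i'']" "ys = [j, j', j'']"
        by (auto simp: length_Suc_conv)
      then show ?thesis using xs ys minor3 by simp
    next
      case 4
      then show ?thesis using xs ys len full minor4 by (metis M4)
    qed
  qed
qed

section \<open>Counting the admissible parameters\<close>

lemma mds_params_1_iff:
  "mds_params 1 b c d \<longleftrightarrow> b \<notin> {0, 1} \<and> c \<notin> {0, 1, b} \<and> d \<notin> forbidden b (c :: 'a)"
proof -
  define s where "s = 1 + b + c"
  have "1 + b + c + d \<noteq> 0 \<longleftrightarrow> d \<noteq> s"
    using char2_add_eq_0_iff[of s d] by (auto simp: s_def)
  then show ?thesis
    unfolding mds_params_def forbidden_def s_def[symmetric]
    by (auto simp: field_simps)
qed

text \<open>Both \<open>0, 1, b, c\<close> and the other four elements are pairwise distinct. Each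
  of the latter has only one possible match among the former: \<open>1 + b + c\<close> with
  \<open>0\<close>, \<open>b * c\<close> with \<open>1\<close>, \<open>b / c\<close> with
  \<open>c\<close>, \<open>c / b\<close> with \<open>b\<close>. Every match costs one
  element.\<close>

lemma card_forbidden:
  assumes "b \<notin> {0, 1}" "c \<notin> {0, 1, b :: 'a}"
  shows "int (card (forbidden b c)) =
    8 - of_bool (c = 1 + b) - of_bool (b * c = 1) - of_bool (b = c * c) - of_bool (c = b * b)"
proof -
  have nz: "b \<noteq> 0" "c \<noteq> 0" "b \<noteq> 1" "c \<noteq> 1" "b \<noteq> c" "c \<noteq> b"
    using assms by auto
  have p: "(1 + b) * (1 + c) \<noteq> 0" "(1 + b) * (b + c) \<noteq> 0" "(1 + c) * (b + c) \<noteq> 0"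
    using nz by (auto simp: char2_add_eq_0_iff)
  have sq: "b * b \<noteq> c * c" "b * b \<noteq> 1" "c * c \<noteq> 1"
    using nz char2_square_eq_iff char2_square_eq_iff[of _ 1] by auto
  \<comment> \<open>A sum of two elements vanishes only if they agree. After clearing denominators,
    these nonzero factorizations separate \<open>1 + b + c\<close> from \<open>b * c\<close>,
    \<open>b / c\<close> and \<open>c / b\<close>.\<close>
  have "1 + b + c + b * c = (1 + b) * (1 + c)" "(1 + b + c) * c + b = (1 + c) * (b + c)"
    "(1 + b + c) * b + c = (1 + b) * (b + c)"
    by (simp_all add: algebra_simps)
  then have "1 + b + c \<noteq> b * c" "1 + b + c \<noteq> b / c" "1 + b + c \<noteq> c / b"
    using p nz by (metis char2_add_eq_0_iff, metis char2_add_eq_0_iff nonzero_eq_divide_eq,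
      metis char2_add_eq_0_iff nonzero_eq_divide_eq)
  \<comment> \<open>Equality would force \<open>c * c = 1\<close>, \<open>b * b = 1\<close> or
    \<open>b * b = c * c\<close>, respectively.\<close>
  moreover have "b * c \<noteq> b / c" "b * c \<noteq> c / b" "b / c \<noteq> c / b"
    using nz sq by (auto simp: field_simps)
  ultimately have dist: "distinct [1 + b + c, b * c, b / c, c / b]"
    by simp
  \<comment> \<open>Regrouped so that equality with \<open>1\<close>, \<open>b\<close> or
    \<open>c\<close> makes the bracketed sum vanish.\<close>
  have "1 + b + c = 1 + (b + c)" "1 + b + c = b + (1 + c)" "1 + b + c = c + (1 + b)"
    by (simp_all only: ac_simps)
  then have x: "1 + b + c \<notin> {1, b, c}"
    using nz by (metis add_cancel_left_right char2_add_eq_0_iff insert_iff empty_iff)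
  have y: "b * c \<notin> {0, b, c}" and z: "b / c \<notin> {0, 1, b}" and w: "c / b \<notin> {0, 1, c}"
    using nz by (auto simp: nonzero_divide_eq_eq)
  have "int (card {x, y, z, w, 0, 1, b, c}) =
      8 - of_bool (x = 0) - of_bool (y = 1) - of_bool (z = c) - of_bool (w = b)"
    if "distinct [x, y, z, w]" "x \<notin> {1, b, c}" "y \<notin> {0, b, c}" "z \<notin> {0, 1, b}" "w \<notin> {0, 1, c}"
    for x y z w
    using that nz by (simp add: card_insert_if)
  from this[OF dist x y z w] have "int (card (forbidden b c)) =
      8 - of_bool (1 + b + c = 0) - of_bool (b * c = 1) - of_bool (b / c = c) - of_bool (c / b = b)"
    unfolding forbidden_def .
  moreover have "1 + b + c = 0 \<longleftrightarrow> c = 1 + b"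
    using char2_add_eq_0_iff[of "1 + b" c] by auto
  moreover have "b / c = c \<longleftrightarrow> b = c * c" "c / b = b \<longleftrightarrow> c = b * b"
    using nz by (simp_all add: nonzero_divide_eq_eq)
  ultimately show ?thesis
    by (simp only:)
qed

end

text \<open>Used to count the solutions of each coincidence equation by a one-variable
  parametrisation.\<close>

lemma sum_of_bool_eq_card_image:
  assumes "finite A" "f ` U \<subseteq> A" "inj_on f U"
    and "\<And>x y. (x, y) \<in> A \<Longrightarrow> P x y \<longleftrightarrow> (x, y) \<in> f ` U"
  shows "(\<Sum>(x, y)\<in>A. of_bool (P x y)) = int (card U)"
proof -
  have "A \<inter> {(x, y). P x y} = f ` U" using assms(2,4) by auto
  then show ?thesis
    using assms(1,3) by (simp add: card_image sum_of_bool_eq case_prod_unfold)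
qed

text \<open>Integers are used because fields with 2 or 4 elements are covered too, where
  \<open>q - 7\<close> and \<open>q - 8\<close> are negative.\<close>

lemma card_mds_params_1:
  assumes two: "(2 :: 'a :: {field, finite}) = 0"
  defines "q \<equiv> int (card (UNIV :: 'a set))"
  shows "int (card {(b, c, d :: 'a). mds_params 1 b c d}) = (q - 2) * (q - 4) * (q - 7)"
proof -
  define U where "U = (UNIV :: 'a set) - {0, 1}"
  define P where "P = (SIGMA b:U. U - {b})"
  have U: "int (card U) = q - 2"
    using card_mono[of "UNIV :: 'a set" "{0, 1}"] by (simp add: U_def q_def card_Diff_subset of_nat_diff)
  have P: "int (card P) = (q - 2) * (q - 3)"
  proof -
    have "int (card (U - {b})) = q - 3" if "b \<in> U" for b
      using that U card_gt_0_iff[of U] by (auto simp: of_nat_diff)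
    then have "(\<Sum>b\<in>U. int (card (U - {b}))) = int (card U) * (q - 3)"
      by simp
    then show ?thesis
      by (simp add: P_def U del: card_Diff_insert card_Diff_singleton)
  qed
  have fin: "finite P"
    by simp
  have sq: "x * x = 1 \<longleftrightarrow> x = 1" and plus: "1 + x = 0 \<longleftrightarrow> x = 1" for x :: 'a
    using char2_square_eq_iff[OF two, of x 1] char2_add_eq_0_iff[OF two, of 1 x] by auto
  have mem_P: "(b, c) \<in> P \<longleftrightarrow> b \<noteq> 0 \<and> b \<noteq> 1 \<and> c \<noteq> 0 \<and> c \<noteq> 1 \<and> c \<noteq> b" for b c
    by (auto simp: P_def U_def)
  have mem_U: "b \<in> U \<longleftrightarrow> b \<noteq> 0 \<and> b \<noteq> 1" for b
    by (auto simp: U_def)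
  \<comment> \<open>For \<open>b\<close> outside \<open>{0, 1}\<close>, each of
    \<open>1 + b\<close>, \<open>1 / b\<close> and \<open>b * b\<close> avoids \<open>0\<close>,
    \<open>1\<close> and \<open>b\<close>, so every graph stays inside \<open>P\<close>.\<close>
  have sum_1: "(\<Sum>(b, c)\<in>P. of_bool (c = 1 + b)) = int (card U)"
    by (rule sum_of_bool_eq_card_image[OF fin, of "\<lambda>b. (b, 1 + b)"])
      (auto simp: mem_P mem_U inj_on_def plus)
  have sum_2: "(\<Sum>(b, c)\<in>P. of_bool (b * c = 1)) = int (card U)"
    by (rule sum_of_bool_eq_card_image[OF fin, of "\<lambda>b. (b, 1 / b)"])
      (auto simp: mem_P mem_U inj_on_def sq nonzero_divide_eq_eq nonzero_eq_divide_eq image_iff mult.commute)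
  \<comment> \<open>Here the second coordinate is the parameter, so no square roots are
    needed.\<close>
  have sum_3: "(\<Sum>(b, c)\<in>P. of_bool (b = c * c)) = int (card U)"
    by (rule sum_of_bool_eq_card_image[OF fin, of "\<lambda>c. (c * c, c)"])
      (auto simp: mem_P mem_U inj_on_def sq)
  have sum_4: "(\<Sum>(b, c)\<in>P. of_bool (c = b * b)) = int (card U)"
    by (rule sum_of_bool_eq_card_image[OF fin, of "\<lambda>b. (b, b * b)"])
      (auto simp: mem_P mem_U inj_on_def sq)
  have "{(b, c, d). mds_params 1 b c d} = (\<lambda>((b, c), d). (b, c, d)) ` (SIGMA (b, c):P. - forbidden b c)"
    by (auto simp: mds_params_1_iff[OF two] P_def U_def image_iff)
  then have "int (card {(b, c, d :: 'a). mds_params 1 b c d}) = int (card (SIGMA (b, c):P. - forbidden b c))"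
    by (simp add: card_image inj_on_def split: prod.splits)
  also have "\<dots> = (\<Sum>(b, c)\<in>P. int (card (- forbidden b c)))"
    by (simp add: case_prod_unfold)
  also have "\<dots> = (\<Sum>(b, c)\<in>P. (q - 8) + of_bool (c = 1 + b) + of_bool (b * c = 1)
      + of_bool (b = c * c) + of_bool (c = b * b))"
  proof (intro sum.cong refl, safe)
    fix b c assume "(b, c) \<in> P"
    then have "b \<notin> {0, 1}" "c \<notin> {0, 1, b}" by (auto simp: P_def U_def)
    moreover have "int (card (- forbidden b c)) = q - int (card (forbidden b c))"
      by (simp add: Compl_eq_Diff_UNIV card_Diff_subset of_nat_diff card_mono q_def)
    ultimately show "int (card (- forbidden b c)) = (q - 8) + of_bool (c = 1 + b) + of_bool (b * c = 1)
        + of_bool (b = c * c) + of_bool (c = b * b)"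
      using card_forbidden[OF two, of b c] by simp
  qed
  also have "\<dots> = int (card P) * (q - 8) + (\<Sum>(b, c)\<in>P. of_bool (c = 1 + b))
      + (\<Sum>(b, c)\<in>P. of_bool (b * c = 1)) + (\<Sum>(b, c)\<in>P. of_bool (b = c * c))
      + (\<Sum>(b, c)\<in>P. of_bool (c = b * b))"
    by (simp only: case_prod_unfold sum.distrib sum_constant)
  also have "\<dots> = (q - 2) * (q - 3) * (q - 8) + 4 * (q - 2)"
    unfolding P sum_1 sum_2 sum_3 sum_4 U by simp
  \<comment> \<open>Indeed \<open>(q - 3) * (q - 8) + 4 = (q - 4) * (q - 7)\<close>.\<close>
  also have "\<dots> = (q - 2) * (q - 4) * (q - 7)"
    by (simp add: algebra_simps)
  finally show ?thesis .
qed

text \<open>Each orbit under scaling by nonzero elements has exactly one member with first entry 1,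
  whence the factor \<open>q - 1\<close>.\<close>

lemma card_mds_params:
  assumes two: "(2 :: 'a :: {field, finite}) = 0"
  defines "q \<equiv> int (card (UNIV :: 'a set))"
  shows "int (card {(a, b, c, d :: 'a). mds_params a b c d}) = (q - 1) * (q - 2) * (q - 4) * (q - 7)"
proof -
  let ?f = "\<lambda>(a, b, c, d). (a, a * b, a * c, a * d :: 'a)"
  let ?A = "(UNIV - {0 :: 'a}) \<times> {(b, c, d :: 'a). mds_params 1 b c d}"
  have scale: "mds_params a (a * b) (a * c) (a * d) \<longleftrightarrow> mds_params 1 b c d" if "a \<noteq> 0" for a b c d :: 'a
    using mds_params_scale[OF that, of 1 b c d] by simp
  have img: "{(a, b, c, d :: 'a). mds_params a b c d} = ?f ` ?A"
  proof (intro equalityI subsetI; clarify)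
    fix a b c d :: 'a
    assume p: "mds_params a b c d"
    then have "a \<noteq> 0" by (simp add: mds_params_def)
    then show "(a, b, c, d) \<in> ?f ` ?A"
      using p scale[of a "b / a" "c / a" "d / a"]
      by (intro image_eqI[of _ _ "(a, b / a, c / a, d / a)"]) auto
  qed (auto intro: scale[THEN iffD2])
  have inj: "inj_on ?f ?A" by (auto simp: inj_on_def)
  have "int (card {(a, b, c, d :: 'a). mds_params a b c d}) = int (card ?A)"
    unfolding img using card_image[OF inj] by (rule arg_cong[of _ _ int])
  also have "\<dots> = (q - 1) * int (card {(b, c, d :: 'a). mds_params 1 b c d})"
    using card_gt_0_iff[of "UNIV :: 'a set"]
    by (simp add: card_cartesian_product card_Diff_subset of_nat_diff q_def)
  finally show ?thesis
    using card_mds_params_1[OF two] by (simp add: q_def mult.assoc)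
qed

section \<open>From parameters back to matrices\<close>

text \<open>The characteristic divides the cardinality, so \<open>2 ^ r\<close> is zero in the
  field, and a field has no nilpotents.\<close>

lemma two_eq_0:
  assumes "card (UNIV :: 'a :: {field, finite} set) = 2 ^ r"
  shows "(2 :: 'a) = 0"
proof -
  have "of_nat (card (UNIV :: 'a set)) = (0 :: 'a)"
    using CHAR_dvd_CARD of_nat_eq_0_iff_char_dvd by blast
  then show ?thesis using assms by simp
qed

theorem theorem2:
  fixes r :: nat
  assumes "r \<ge> 3"
    and "card (UNIV :: 'a :: {field, finite} set) = 2 ^ r"
  shows "card {M :: 'a mat. (\<exists>a b c d. M = Hada a b c d) \<and> mds_mat M}
       = (2 ^ r - 1) * (2 ^ r - 2) * (2 ^ r - 4) * (2 ^ r - 7)"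
proof -
  let ?H = "\<lambda>(a, b, c, d). Hada a b c d :: 'a mat"
  let ?S = "{(a, b, c, d). mds_params a b c d} :: ('a \<times> 'a \<times> 'a \<times> 'a) set"
  have "{M :: 'a mat. (\<exists>a b c d. M = Hada a b c d) \<and> mds_mat M} = ?H ` ?S"
    using mds_mat_Hada_iff[OF two_eq_0[OF assms(2)]] by (auto simp: image_iff) blast
  moreover have "inj_on ?H ?S" by (auto simp: inj_on_def Hada_inject)
  ultimately have card: "card {M :: 'a mat. (\<exists>a b c d. M = Hada a b c d) \<and> mds_mat M} = card ?S"
    by (simp add: card_image)
  \<comment> \<open>Subtraction of naturals truncates; \<open>r \<ge> 3\<close> gives
    \<open>2 ^ r \<ge> 8\<close>, so all four differences are genuine.\<close>
  have "int ((n - 1) * (n - 2) * (n - 4) * (n - 7)) = (int n - 1) * (int n - 2) * (int n - 4) * (int n - 7)"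
    if "2 ^ 3 \<le> n" for n :: nat
    using that by (simp add: of_nat_diff)
  moreover have "2 ^ 3 \<le> (2 ^ r :: nat)"
    using assms(1) by (intro power_increasing) auto
  ultimately have "int ((2 ^ r - 1) * (2 ^ r - 2) * (2 ^ r - 4) * (2 ^ r - 7)) =
      (int (2 ^ r) - 1) * (int (2 ^ r) - 2) * (int (2 ^ r) - 4) * (int (2 ^ r) - 7)"
    by blast
  then have "int (card ?S) = int ((2 ^ r - 1) * (2 ^ r - 2) * (2 ^ r - 4) * (2 ^ r - 7))"
    using card_mds_params[OF two_eq_0[OF assms(2)]] assms(2) by (simp only:)
  then show ?thesis using card by linarith
qed

end
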